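(* Let $\Sigma$ be a topological space. Then $(\mathbb{TT}, \frown, \langle\rangle)$ is a trace algebra.
   Context: A trace algebra $(\mathcal{T}, \frown, \langle\rangle)$ is a set $\mathcal{T}$ with a binary operation $\frown$ and an element $\langle\rangle \in \mathcal{T}$ such that for all $x,y,z \in \mathcal{T}$: $x \frown y \in \mathcal{T}$; $x \frown (y \frown z) = (x \frown y) \frown z$; $\langle\rangle \frown x = x \frown \langle\rangle = x$; $x \frown y = x \frown z \implies y = z$; $x \frown z = y \frown z \implies x = y$; and $x \frown y = \langle\rangle \implies x = \langle\rangle$. For a partial function $f : \mathbb{R}_{\ge 0} \rightharpoonup \Sigma$ and $n \in \mathbb{R}_{\ge 0}$, the shift $f \triangleright n$ is $\lambda x.\ f(x - n)$ (defined at $x$ exactly when $x \ge n$ and $x-n \in \mathrm{dom}(f)$). $\mathrm{end}(f) = \min(\mathbb{R}_{\ge 0} \setminus \mathrm{dom}(f))$, $\langle\rangle = \emptyset$ (the empty function), and $f \frown g = f \cup (g \triangleright \mathrm{end}(f))$ (union of graphs). The set of timed traces $\mathbb{TT}$ consists of those $f : \mathbb{R}_{\ge 0} \rightharpoonup \Sigma$ such that there is $t \in \mathbb{R}_{\ge 0}$ with $\mathrm{dom}(f) = [0,t)$ and, if $t > 0$, there is a finite strictly increasing sequence of reals $I = \langle I_0, \dots, I_{k-1}\rangle$ with $\mathrm{ran}(I) \subseteq [0,t]$, $\{0,t\} \subseteq \mathrm{ran}(I)$, and for every $n < k-1$ and every $s \in [I_n, I_{n+1})$, $\lim_{x \to s^+}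 f(x) = f(s)$. *)

theory Defs
  imports "HOL-Analysis.Abstract_Limits"
begin

locale trace_algebra =
  fixes T :: "'t set"
    and conc :: "'t \<Rightarrow> 't \<Rightarrow> 't"  (infixl "\<frown>" 65)
    and emp :: 't
  assumes emp_closed: "emp \<in> T"
    and conc_closed: "\<lbrakk>x \<in> T; y \<in> T\<rbrakk> \<Longrightarrow> x \<frown> y \<in> T"
    and conc_assoc: "\<lbrakk>x \<in> T; y \<in> T; z \<in> T\<rbrakk> \<Longrightarrow> x \<frown> (y \<frown> z) = (x \<frown> y) \<frown> z"
    and emp_left: "x \<in> T \<Longrightarrow> emp \<frown> x = x"
    and emp_right: "x \<in> T \<Longrightarrow> x \<frown> emp = x"
    and left_cancel: "\<lbrakk>x \<in> T; y \<in> T; z \<in> T; x \<frown> y = x \<frown> z\<rbrakk> \<Longrightarrow> y = z"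
    and right_cancel: "\<lbrakk>x \<in> T; y \<in> T; z \<in> T; x \<frown> z = y \<frown> z\<rbrakk> \<Longrightarrow> x = y"
    and no_inverses: "\<lbrakk>x \<in> T; y \<in> T; x \<frown> y = emp\<rbrakk> \<Longrightarrow> x = emp"

text \<open>A partial function on the nonnegative reals is a map \<open>f :: real \<rightharpoonup> 'a\<close> with
  \<open>dom f \<subseteq> {0..}\<close>.\<close>

definition shift :: "(real \<rightharpoonup> 'a) \<Rightarrow> real \<Rightarrow> (real \<rightharpoonup> 'a)"
  where "shift f n = (\<lambda>x. if x \<ge> n then f (x - n) else None)"

text \<open>The constant \<open>Min\<close> only concerns finite sets; the minimum of a set of reals is its
  least element.\<close>

definition end_time :: "(real \<rightharpoonup> 'a) \<Rightarrow> real"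
  where "end_time f = (LEAST t. t \<in> {0..} - dom f)"

text \<open>Concatenation is the partial function whose graph is the union of the two graphs. It is
  unspecified if that union is not single-valued; for disjoint domains it is \<open>(++)\<close>, see
  \<open>trace_concat_eq_map_add\<close> below.\<close>

definition trace_concat :: "(real \<rightharpoonup> 'a) \<Rightarrow> (real \<rightharpoonup> 'a) \<Rightarrow> (real \<rightharpoonup> 'a)"
  where "trace_concat f g =
    (THE h. Map.graph h = Map.graph f \<union> Map.graph (shift g (end_time f)))"

lemma graph_eqD:
  assumes "Map.graph h = Map.graph k"
  shows "h = k"
proof
  fix x
  have "h x = Some v \<longleftrightarrow> k x = Some v" for v
  proof
    assume "h x = Some v"
    then have "(x, v) \<in> Map.graph h" by (rule in_graphI)
    then show "k x = Some v" unfolding assms by (rule in_graphD)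
  next
    assume "k x = Some v"
    then have "(x, v) \<in> Map.graph k" by (rule in_graphI)
    then show "h x = Some v" unfolding assms[symmetric] by (rule in_graphD)
  qed
  then show "h x = k x"
    by (metis option.exhaust)
qed

lemma trace_concat_eq_map_add:
  assumes "dom f \<inter> dom (shift g (end_time f)) = {}"
  shows "trace_concat f g = f ++ shift g (end_time f)"
  unfolding trace_concat_def
proof (rule the_equality)
  show "Map.graph (f ++ shift g (end_time f)) = Map.graph f \<union> Map.graph (shift g (end_time f))"
    using assms by (rule graph_map_add)
next
  fix h
  assume "Map.graph h = Map.graph f \<union> Map.graph (shift g (end_time f))"
  also have "\<dots> = Map.graph (f ++ shift g (end_time f))"
    using assms by (rule graph_map_add[symmetric])
  finally show "h = f ++ shift g (end_time f)"
    by (rule graph_eqD)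
qed

text \<open>The space may have any carrier \<open>topspace \<Sigma>\<close>, including the empty one. The limit at \<open>s\<close> only
  concerns points where \<open>f\<close> is defined, since \<open>s < t\<close> and \<open>dom f = {0..<t}\<close>; it is not assumed to
  be unique, so the equation with \<open>f s\<close> is read as convergence to \<open>f s\<close>.\<close>

definition timed_traces :: "'a topology \<Rightarrow> (real \<rightharpoonup> 'a) set"
  where "timed_traces \<Sigma> = {f. ran f \<subseteq> topspace \<Sigma> \<and>
    (\<exists>t\<ge>0. dom f = {0..<t} \<and>
      (t > 0 \<longrightarrow>
        (\<exists>I :: real list. sorted_wrt (<) I \<and> set I \<subseteq> {0..t} \<and> {0, t} \<subseteq> set I \<and>
          (\<forall>n < length I - 1. \<forall>s \<in> {I ! n..<I ! (n + 1)}.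
            limitin \<Sigma> (\<lambda>x. the (f x)) (the (f s)) (at_right s)))))}"

end

(* A partition I of [0,t] in the definition of a timed trace carries no information: the half-open
   pieces [I_n, I_(n+1)) cover [0,t), so the condition says exactly that f is right-continuous on
   [0,t), and conversely the partition 0 < t is then a witness. For domains [0,a) and [0,b), the
   concatenation is f on [0,a) and the translate of g on [a,a+b), and translation preserves
   limits from the right. *)

theory Submission imports Defs begin

text \<open>The left end of the piece is the predecessor of the least index whose entry exceeds
  \<open>s\<close>. This index exists because \<open>s < b\<close>, and it is positive because
  sortedness gives \<open>I ! 0 \<le> a \<le> s\<close>.\<close>

lemma in_some_piece:
  fixes I :: "'a::linorder list"
  assumes "sorted_wrt (<) I" "a \<in> set I" "b \<in> set I" "a \<le> s" "s < b"
  obtains n where "n < length I - 1" "s \<in> {I ! n..<I ! (n + 1)}"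
proof -
  obtain i j where i: "i < length I" "I ! i = a" and j: "j < length I" "I ! j = b"
    using assms(2,3) by (meson in_set_conv_nth)
  define k where "k = (LEAST k. s < I ! k)"
  have k: "s < I ! k" and kj: "k \<le> j"
    using assms(5) j by (auto simp: k_def intro: LeastI Least_le)
  have "\<not> s < I ! 0"
  proof (cases "i = 0")
    case True
    then show ?thesis using i assms(4) by auto
  next
    case False
    then have "I ! 0 < I ! i"
      using assms(1) i(1) by (intro sorted_wrt_nth_less) auto
    then show ?thesis using i assms(4) by auto
  qed
  with k obtain n where n: "k = Suc n"
    by (cases k) auto
  then have "\<not> s < I ! n"
    unfolding k_def by (intro not_less_Least) simp
  with k kj j n show ?thesis
    by (intro that[of n]) auto
qed

lemma timed_traces_iff:
  "f \<in> timed_traces \<Sigma> \<longleftrightarrow> ran f \<subseteq> topspace \<Sigma> \<and>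
    (\<exists>t\<ge>0. dom f = {0..<t} \<and>
      (\<forall>s\<in>{0..<t}. limitin \<Sigma> (\<lambda>x. the (f x)) (the (f s)) (at_right s)))"
    (is "_ \<longleftrightarrow> _ \<and> (\<exists>t\<ge>0. dom f = {0..<t} \<and> ?rc t)")
proof -
  have "(t > 0 \<longrightarrow>
        (\<exists>I :: real list. sorted_wrt (<) I \<and> set I \<subseteq> {0..t} \<and> {0, t} \<subseteq> set I \<and>
          (\<forall>n < length I - 1. \<forall>s \<in> {I ! n..<I ! (n + 1)}.
            limitin \<Sigma> (\<lambda>x. the (f x)) (the (f s)) (at_right s)))) \<longleftrightarrow> ?rc t"
    (is "?part t \<longleftrightarrow> _") for t
  proof
    assume part: "?part t"
    show "?rc t"
    proof
      fix s assume s: "s \<in> {0..<t}"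
      \<comment> \<open>A point of \<open>{0..<t}\<close> discharges the guard \<open>t > 0\<close>;
        for \<open>t = 0\<close> both conditions are vacuous.\<close>
      then have "t > 0" by auto
      with part obtain I :: "real list" where I: "sorted_wrt (<) I" "0 \<in> set I" "t \<in> set I"
        and lim: "\<And>n s. n < length I - 1 \<Longrightarrow> s \<in> {I ! n..<I ! (n + 1)} \<Longrightarrow>
          limitin \<Sigma> (\<lambda>x. the (f x)) (the (f s)) (at_right s)"
        by auto
      from s obtain n where "n < length I - 1" "s \<in> {I ! n..<I ! (n + 1)}"
        using in_some_piece[OF I] by auto
      then show "limitin \<Sigma> (\<lambda>x. the (f x)) (the (f s)) (at_right s)"
        by (rule lim)
    qed
  next
    assume "?rc t"
    then show "?part t"
      by (intro impI exI[of _ "[0, t]"]) auto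
  qed
  then show ?thesis
    by (simp add: timed_traces_def)
qed

lemma end_time_eq:
  assumes "dom f = {0..<a}" "0 \<le> a"
  shows "end_time f = a"
  unfolding end_time_def using assms by (intro Least_equality) auto

text \<open>\<open>f\<close> lives below \<open>a\<close> and the shifted \<open>g\<close> from
  \<open>a\<close> on, so the graphs are disjoint and the description in
  \<open>trace_concat_def\<close> denotes a map. All later computations use this case form.\<close>

lemma trace_concat_apply:
  assumes "dom f = {0..<a}" "0 \<le> a"
  shows "trace_concat f g = (\<lambda>x. if x < a then f x else g (x - a))"
proof -
  \<comment> \<open>\<open>(++)\<close> falls back to \<open>f\<close> where the shifted
    \<open>g\<close> is undefined; from \<open>a\<close> on that fallback must be
    \<open>None\<close>.\<close>
  have None: "f x = None" if "\<not> x < a" for x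
    using assms that by (metis atLeastLessThan_iff domIff)
  have "dom f \<inter> dom (shift g a) = {}"
    using assms by (auto simp: shift_def split: if_splits)
  then have "trace_concat f g = f ++ shift g a"
    using trace_concat_eq_map_add[of f g] end_time_eq[OF assms] by simp
  then show ?thesis
    by (auto simp: fun_eq_iff map_add_def shift_def None split: option.split)
qed

text \<open>Lengths add, which later lets right cancellation and the absence of inverses be decided
  on lengths alone before values are compared.\<close>

lemma dom_trace_concat:
  assumes "dom f = {0..<a}" "0 \<le> a" "dom g = {0..<b}" "0 \<le> b"
  shows "dom (trace_concat f g) = {0..<a + b}"
proof -
  have "x \<in> dom (trace_concat f g) \<longleftrightarrow> (if x < a then x \<in> dom f else x - a \<in> dom g)" for x
    by (simp add: trace_concat_apply[OF assms(1,2)] dom_def)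
  then show ?thesis
    using assms by (intro set_eqI) auto
qed

text \<open>Translation by \<open>a\<close> maps the filter \<open>at_right s\<close> to
  \<open>at_right (s - a)\<close>.\<close>

lemma limitin_at_right_shift:
  "limitin X (\<lambda>x. f (x - a)) l (at_right s) \<longleftrightarrow> limitin X f l (at_right (s - a :: real))"
  by (simp add: limitin_def filtermap_at_right_shift[symmetric] eventually_filtermap)

text \<open>Allows the concatenation to be replaced under a right limit by whichever piece it agrees
  with just after the point.\<close>

lemma limitin_cong:
  assumes "\<forall>\<^sub>F x in F. f x = g x"
  shows "limitin X f l F \<longleftrightarrow> limitin X g l F"
  using assms limitin_transform_eventually[OF assms]
    limitin_transform_eventually[of g f F X l] by (auto simp: eq_commute)

lemma timed_traces_concat:
  assumes "f \<in> timed_traces \<Sigma>" "g \<in> timed_traces \<Sigma>"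
  shows "trace_concat f g \<in> timed_traces \<Sigma>"
proof -
  obtain a where a: "0 \<le> a" "dom f = {0..<a}"
    and f: "\<And>s. s \<in> {0..<a} \<Longrightarrow> limitin \<Sigma> (\<lambda>x. the (f x)) (the (f s)) (at_right s)"
    using assms(1) by (auto simp: timed_traces_iff)
  obtain b where b: "0 \<le> b" "dom g = {0..<b}"
    and g: "\<And>s. s \<in> {0..<b} \<Longrightarrow> limitin \<Sigma> (\<lambda>x. the (g x)) (the (g s)) (at_right s)"
    using assms(2) by (auto simp: timed_traces_iff)
  define h where "h = trace_concat f g"
  have h: "h = (\<lambda>x. if x < a then f x else g (x - a))"
    using a by (simp add: h_def trace_concat_apply)
  have "ran h \<subseteq> ran f \<union> ran g"
    by (auto simp: h ran_def split: if_splits)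
  then have "ran h \<subseteq> topspace \<Sigma>"
    using assms by (auto simp: timed_traces_iff)
  moreover have "dom h = {0..<a + b}"
    unfolding h_def using a b by (intro dom_trace_concat)
  moreover have "limitin \<Sigma> (\<lambda>x. the (h x)) (the (h s)) (at_right s)" if s: "s \<in> {0..<a + b}" for s
  \<comment> \<open>The junction \<open>s = a\<close> belongs to the second case: only points after
    it matter, so its limit is that of \<open>g\<close> at 0 and a jump there is harmless.\<close>
  proof (cases "s < a")
    case True
    have "\<forall>\<^sub>F x in at_right s. x < a"
      using eventually_at_right_real[OF True] by (rule eventually_mono) auto
    then have "\<forall>\<^sub>F x in at_right s. the (h x) = the (f x)"
      by (rule eventually_mono) (simp add: h)
    \<comment> \<open>\<open>h\<close> is unfolded only in the second \<open>simp\<close>, after the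
      function under the limit has been exchanged.\<close>
    then show ?thesis
      using f[of s] s True by (simp add: limitin_cong) (simp add: h)
  next
    case False
    have "\<forall>\<^sub>F x in at_right s. s < x"
      by (simp add: eventually_at_filter)
    then have "\<forall>\<^sub>F x in at_right s. the (h x) = the (g (x - a))"
      by (rule eventually_mono) (use False in \<open>simp add: h\<close>)
    then show ?thesis
      using g[of "s - a"] s False
      by (simp add: limitin_cong limitin_at_right_shift[where f = "\<lambda>x. the (g x)"]) (simp add: h)
  qed
  ultimately show ?thesis
    unfolding h_def[symmetric] timed_traces_iff using a b by (auto intro!: exI[of _ "a + b"])
qed

theorem theorem7:
  fixes \<Sigma> :: "'a topology"
  shows "trace_algebra (timed_traces \<Sigma>) trace_concat Map.empty"
proof -
  have dom: "\<exists>t\<ge>0. dom f = {0..<t}" if "f \<in> timed_traces \<Sigma>" for f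
    using that by (auto simp: timed_traces_iff)
  have empty: "(Map.empty :: real \<rightharpoonup> 'a) \<in> timed_traces \<Sigma>"
    by (auto simp: timed_traces_iff)
  show ?thesis
  proof
    show "Map.empty \<in> timed_traces \<Sigma>"
      by (rule empty)
  next
    fix x y assume "x \<in> timed_traces \<Sigma>" "y \<in> timed_traces \<Sigma>"
    then show "trace_concat x y \<in> timed_traces \<Sigma>"
      by (rule timed_traces_concat)
  next
    fix x y z assume T: "x \<in> timed_traces \<Sigma>" "y \<in> timed_traces \<Sigma>" "z \<in> timed_traces \<Sigma>"
    obtain a where a: "dom x = {0..<a}" "0 \<le> a" using dom[OF T(1)] by auto
    obtain b where b: "dom y = {0..<b}" "0 \<le> b" using dom[OF T(2)] by auto
    have xy: "dom (trace_concat x y) = {0..<a + b}" "0 \<le> a + b"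
      using a b by (auto simp: dom_trace_concat)
    show "trace_concat x (trace_concat y z) = trace_concat (trace_concat x y) z"
      \<comment> \<open>The outer concatenation goes first, while its argument still has the form
        \<open>trace_concat x y\<close>. Both sides then switch from \<open>x\<close> to
        \<open>y\<close> at \<open>a\<close> and from \<open>y\<close> to \<open>z\<close> at
        \<open>a + b\<close>.\<close>
      unfolding trace_concat_apply[OF xy]
      unfolding trace_concat_apply[OF a] trace_concat_apply[OF b]
      using b by (intro ext) (simp add: less_diff_eq diff_less_eq diff_diff_eq add.commute)
  next
    fix x assume T: "x \<in> timed_traces \<Sigma>"
    obtain a where a: "dom x = {0..<a}" "0 \<le> a" using dom[OF T] by auto
    have e: "dom (Map.empty :: real \<rightharpoonup> 'a) = {0..<0}" by simp
    \<comment> \<open>With end 0, the concatenation is \<open>None\<close> at negative points, so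
      \<open>x\<close> must be undefined there too.\<close>
    have "x s = None" if "s < 0" for s
      using a that by (metis domIff atLeastLessThan_iff not_le)
    then show "trace_concat Map.empty x = x"
      unfolding trace_concat_apply[OF e order_refl] by (auto simp: fun_eq_iff)
  next
    fix x assume T: "x \<in> timed_traces \<Sigma>"
    obtain a where a: "dom x = {0..<a}" "0 \<le> a" using dom[OF T] by auto
    show "trace_concat x Map.empty = x"
    proof
      fix s
      have "x s = None" if "\<not> s < a"
        using a that by (metis domIff atLeastLessThan_iff)
      then show "trace_concat x Map.empty s = x s"
        by (simp add: trace_concat_apply[OF a])
    qed
  next
    fix x y z assume T: "x \<in> timed_traces \<Sigma>" "y \<in> timed_traces \<Sigma>" "z \<in> timed_traces \<Sigma>"
      and eq: "trace_concat x y = trace_concat x z"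
    obtain a where a: "dom x = {0..<a}" "0 \<le> a" using dom[OF T(1)] by auto
    show "y = z"
    proof
      fix s
      show "y s = z s"
      proof (cases "0 \<le> s")
        case True
        \<comment> \<open>Since \<open>0 \<le> s\<close>, the point \<open>s + a\<close> is past the
          end of \<open>x\<close>, where the two sides read \<open>y s\<close> and
          \<open>z s\<close>.\<close>
        then show ?thesis
          using fun_cong[OF eq, of "s + a"] by (simp add: trace_concat_apply[OF a])
      next
        case False
        then have "y s = None" "z s = None"
          using dom[OF T(2)] dom[OF T(3)] by (metis domIff atLeastLessThan_iff)+
        then show ?thesis by simp
      qed
    qed
  next
    fix x y z assume T: "x \<in> timed_traces \<Sigma>" "y \<in> timed_traces \<Sigma>" "z \<in> timed_traces \<Sigma>"
      and eq: "trace_concat x z = trace_concat y z"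
    obtain a where a: "dom x = {0..<a}" "0 \<le> a" using dom[OF T(1)] by auto
    obtain b where b: "dom y = {0..<b}" "0 \<le> b" using dom[OF T(2)] by auto
    obtain c where c: "dom z = {0..<c}" "0 \<le> c" using dom[OF T(3)] by auto
    have "{0..<a + c} = {0..<b + c}"
      using arg_cong[OF eq, of dom] dom_trace_concat[OF a c] dom_trace_concat[OF b c] by simp
    \<comment> \<open>Nonempty intervals have equal right ends; if both are empty, nonnegativity
      gives \<open>a = b = 0\<close>.\<close>
    then have ab: "a = b"
      using a b c by (auto simp: Ico_eq_Ico)
    show "x = y"
    proof
      fix s
      show "x s = y s"
      proof (cases "s < a")
        case True
        then show ?thesis
          using fun_cong[OF eq, of s] by (simp add: trace_concat_apply[OF a] trace_concat_apply[OF b] ab)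
      next
        case False
        then have "x s = None" "y s = None"
          using a b ab by (metis domIff atLeastLessThan_iff)+
        then show ?thesis by simp
      qed
    qed
  next
    fix x y assume T: "x \<in> timed_traces \<Sigma>" "y \<in> timed_traces \<Sigma>"
      and eq: "trace_concat x y = Map.empty"
    obtain a where a: "dom x = {0..<a}" "0 \<le> a" using dom[OF T(1)] by auto
    obtain b where b: "dom y = {0..<b}" "0 \<le> b" using dom[OF T(2)] by auto
    have "{0..<a + b} = {}"
      using arg_cong[OF eq, of dom] dom_trace_concat[OF a b] by simp
    \<comment> \<open>The total length \<open>a + b\<close> is at most 0 with both summands
      nonnegative, so \<open>a = 0\<close>.\<close>
    then have "dom x = {}"
      using a b by auto
    then show "x = Map.empty" by simp
  qed
qed

end
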